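(* If $m$ is an odd integer and $m\equiv1\pmod 4$, then there exists a positive integer $K=L_2(m)$ such that $$o_{2^l}(m)=\begin{cases}1&\text{if }1\le l\le K\\ 2^{l-K}&\text{if }l>K;\end{cases}$$ if $m\equiv3\pmod4$, then there exists a positive integer $L=L_2(m)$ such that $$o_{2^l}(m)=\begin{cases}1&\text{if }l=1\\ 2&\text{if }1<l\le L\\ 2^{l-(L-1)}&\text{if }l>L.\end{cases}$$
   Context: For $p$ prime and $m\in\mathbb{N}$ (the nonnegative integers) such that $(m,p)=1$, $o_{p^l}(m)$ denotes the order of $m$ in the group of units $\mathcal{U}(\mathbb{Z}/p^l\mathbb{Z})$; here $p=2$ and $l\ge1$. $L_2(m)$ is a name for the integer whose existence is asserted.
   Formalization: The values m = 1 (first claim) and m = -1 (second claim) are excluded: there the order is 1 for all l, respectively 2 for all l ≥ 2, so no finite K or L exists and the claim as stated fails. *)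

theory Defs
  imports "HOL-Number_Theory.Residues"
begin

text \<open>
  The order \<open>o\<close> of the class of \<open>m\<close> in the group of units of the ring of integers modulo \<open>p ^ l\<close>.
  The elements of \<^const>\<open>residue_ring\<close> are the representatives \<open>{0..p ^ l - 1}\<close>, so \<open>m\<close> must be
  reduced first. The value is only meaningful if \<open>p ^ l > 1\<close> and \<open>m\<close> is coprime to \<open>p\<close>.
\<close>

definition unit_order :: "nat \<Rightarrow> nat \<Rightarrow> int \<Rightarrow> nat"
  where "unit_order p l m =
    group.ord (units_of (residue_ring (int p ^ l))) (m mod int p ^ l)"

end

theory Submission
  imports Defs
begin

text \<open>
  The only arithmetic fact is that squaring raises the \<open>2\<close>-adic valuation of \<open>x - 1\<close> by exactly
  one once this valuation is at least \<open>2\<close> (\<open>square_one_plus_power_2\<close>). Hence, with \<open>K\<close> the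
  valuation of \<open>m - 1\<close> and \<open>m \<equiv> 1\<close> modulo \<open>4\<close>, the congruence \<open>m\<^bsup>2^j\<^esup> \<equiv> 1\<close> modulo \<open>2\<^sup>l\<close> says
  precisely that \<open>l \<le> K + j\<close> (\<open>iterated_square_cong_1\<close>). A natural number is determined by which
  powers of \<open>2\<close> it divides, provided it divides one, so the order is \<open>2\<^bsup>l - K\<^esup>\<close>, with truncated
  subtraction covering the case \<open>l \<le> K\<close>.

  For \<open>m \<equiv> 3\<close> modulo \<open>4\<close> the square \<open>m\<^sup>2\<close> is \<open>1\<close> modulo \<open>4\<close>, and the same result applied to
  it controls all exponents \<open>2\<^bsup>j + 1\<^esup>\<close>. The remaining exponent \<open>1\<close> is never a period when
  \<open>l > 1\<close>, since already \<open>m \<noteq> 1\<close> modulo \<open>4\<close>. So \<open>L\<close> is the valuation of \<open>m\<^sup>2 - 1\<close>, and the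
  order is \<open>2\<^bsup>(l - L) + 1\<^esup>\<close>.

  The exclusion of \<open>1\<close> and \<open>-1\<close> is what makes the two valuations finite.
\<close>

lemma unit_order_dvd_iff:
  assumes "prime p" "l \<ge> 1" "coprime m (int p)"
  shows "unit_order p l m dvd n \<longleftrightarrow> [m ^ n = 1] (mod int p ^ l)"
proof -
  define q where "q = int p ^ l"
  have "1 < int p" using assms(1) prime_gt_1_nat by fastforce
  then have q: "1 < q" using assms(2) by (simp add: q_def)
  interpret residues q "residue_ring q"
    using q by unfold_locales simp_all
  let ?R = "residue_ring q"
  interpret U: group "units_of ?R" by (rule units_group)
  have unit: "m mod q \<in> Units ?R"
    using assms(3) q by (intro mod_in_res_units) (auto simp: q_def)
  have "unit_order p l m dvd n \<longleftrightarrow> (m mod q) [^]\<^bsub>units_of ?R\<^esub> n = \<one>\<^bsub>units_of ?R\<^esub>"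
    using U.pow_eq_id[of "m mod q" n] unit
    by (simp add: unit_order_def q_def units_of_carrier)
  also have "\<dots> \<longleftrightarrow> m ^ n mod q = 1"
    using unit by (simp add: units_of_pow units_of_one pow_cong res_one_eq)
  also have "\<dots> \<longleftrightarrow> [m ^ n = 1] (mod q)"
    using q by (simp add: cong_def)
  finally show ?thesis by (simp add: q_def)
qed

text \<open>Any divisor of a prime power is a prime power, and its exponent is the least admissible one.\<close>

lemma eq_prime_power_if_dvd_iff:
  fixes d p :: nat
  assumes "prime p" and dvd: "\<And>j. d dvd p ^ j \<longleftrightarrow> r \<le> j"
  shows "d = p ^ r"
proof -
  obtain s where s: "s \<le> r" "d = p ^ s"
    using dvd[of r] divides_primepow_nat[OF assms(1), of d r] by auto
  then have "r \<le> s" using dvd[of s] by simp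
  with s show ?thesis by simp
qed

text \<open>
  Write \<open>(1 + 2\<^sup>k u)\<^sup>2 = 1 + 2\<^bsup>k + 1\<^esup> u (1 + 2\<^bsup>k - 1\<^esup> u)\<close>; the last factor is odd because
  \<open>k - 1\<close> is positive. This is where the residue \<open>1\<close> modulo \<open>4\<close>, rather than merely an odd
  base, matters.
\<close>

lemma square_one_plus_power_2:
  fixes u :: int
  assumes "k \<ge> 2" "odd u"
  shows "\<exists>v. odd v \<and> (1 + 2 ^ k * u)\<^sup>2 = 1 + 2 ^ Suc k * v"
proof -
  obtain i where i: "k = Suc (Suc i)"
    using assms(1) by (metis add_2_eq_Suc le_Suc_ex)
  have "(1 + 2 ^ k * u)\<^sup>2 = 1 + 2 ^ Suc k * (u * (1 + 2 ^ Suc i * u))"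
    by (simp add: i power2_eq_square algebra_simps)
  moreover have "odd (u * (1 + 2 ^ Suc i * u))"
    using assms(2) by simp
  ultimately show ?thesis by blast
qed

lemma iterated_square_one_plus_power_2:
  fixes u :: int
  assumes "k \<ge> 2" "odd u"
  shows "\<exists>v. odd v \<and> (1 + 2 ^ k * u) ^ 2 ^ j = 1 + 2 ^ (k + j) * v"
proof (induction j)
  case 0
  show ?case using assms(2) by auto
next
  case (Suc j)
  then obtain v where v: "odd v" "(1 + 2 ^ k * u) ^ 2 ^ j = 1 + 2 ^ (k + j) * v"
    by blast
  have "(1 + 2 ^ k * u) ^ 2 ^ Suc j = (1 + 2 ^ (k + j) * v)\<^sup>2"
    by (simp only: v(2)[symmetric] power_mult[symmetric] power_Suc2)
  then show ?case
    using square_one_plus_power_2[of "k + j" v] assms(1) v(1) by simp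
qed

lemma power_2_dvd_power_2_mult_odd_iff:
  fixes v :: int
  assumes "odd v"
  shows "2 ^ l dvd 2 ^ a * v \<longleftrightarrow> l \<le> a"
proof
  assume "2 ^ l dvd 2 ^ a * v"
  moreover have "coprime (2 ^ l) v" using assms by simp
  ultimately have "(2::int) ^ l dvd 2 ^ a"
    by (simp add: coprime_dvd_mult_left_iff)
  then have "(2::int) ^ l \<le> 2 ^ a" by (rule zdvd_imp_le) simp
  then show "l \<le> a" by simp
next
  assume "l \<le> a"
  then show "2 ^ l dvd 2 ^ a * v" by (simp add: le_imp_power_dvd)
qed

lemma iterated_square_cong_1:
  fixes m :: int
  assumes "[m = 1] (mod 4)" "m \<noteq> 1"
  obtains K where "K \<ge> 2" "\<And>l j. [m ^ 2 ^ j = 1] (mod 2 ^ l) \<longleftrightarrow> l \<le> K + j"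
proof -
  obtain u where u: "m - 1 = 2 ^ multiplicity 2 (m - 1) * u" "odd u"
    using multiplicity_decompose'[of "m - 1" 2] assms(2) by auto
  define K where "K = multiplicity 2 (m - 1)"
  have m: "m = 1 + 2 ^ K * u" using u(1) by (simp add: K_def)
  have "2 ^ 2 dvd 2 ^ K * u"
    using assms(1) by (simp add: m cong_iff_dvd_diff)
  then have K: "K \<ge> 2"
    using power_2_dvd_power_2_mult_odd_iff[OF u(2)] by blast
  have "[m ^ 2 ^ j = 1] (mod 2 ^ l) \<longleftrightarrow> l \<le> K + j" for l j
  proof -
    obtain v where "odd v" "m ^ 2 ^ j = 1 + 2 ^ (K + j) * v"
      using iterated_square_one_plus_power_2[OF K u(2)] m by blast
    then show ?thesis
      by (simp add: cong_iff_dvd_diff power_2_dvd_power_2_mult_odd_iff)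
  qed
  with K show ?thesis using that by blast
qed

theorem propositionA1:
  fixes m :: int
  assumes "odd m"
  shows "([m = 1] (mod 4) \<and> m \<noteq> 1 \<longrightarrow>
      (\<exists>K::nat. K > 0 \<and>
        (\<forall>l\<ge>1. unit_order 2 l m = (if l \<le> K then 1 else 2 ^ (l - K))))) \<and>
    ([m = 3] (mod 4) \<and> m \<noteq> -1 \<longrightarrow>
      (\<exists>L::nat. L > 0 \<and>
        (\<forall>l\<ge>1. unit_order 2 l m =
          (if l = 1 then 1 else if l \<le> L then 2 else 2 ^ (l - (L - 1))))))"
proof (intro conjI impI; elim conjE)
  have dvd_iff: "unit_order 2 l m dvd n \<longleftrightarrow> [m ^ n = 1] (mod 2 ^ l)" if "l \<ge> 1" for l n
    using unit_order_dvd_iff[of 2 l m n] that assms by simp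
  {
    assume "[m = 1] (mod 4)" "m \<noteq> 1"
    then obtain K where K: "K \<ge> 2" "\<And>l j. [m ^ 2 ^ j = 1] (mod 2 ^ l) \<longleftrightarrow> l \<le> K + j"
      using iterated_square_cong_1 by blast
    have "unit_order 2 l m = 2 ^ (l - K)" if "l \<ge> 1" for l
      by (rule eq_prime_power_if_dvd_iff) (auto simp: dvd_iff[OF that] K(2))
    then show "\<exists>K>0. \<forall>l\<ge>1. unit_order 2 l m = (if l \<le> K then 1 else 2 ^ (l - K))"
      using K(1) by (intro exI[of _ K]) auto
  next
    assume m: "[m = 3] (mod 4)" "m \<noteq> -1"
    have "[m\<^sup>2 = 3\<^sup>2] (mod 4)" using m(1) by (rule cong_pow)
    then have "[m\<^sup>2 = 1] (mod 4)" by (simp add: cong_def)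
    moreover have "m\<^sup>2 \<noteq> 1"
      using m by (auto simp: power2_eq_1_iff cong_def)
    ultimately obtain L where
      L: "L \<ge> 2" "\<And>l j. [(m\<^sup>2) ^ 2 ^ j = 1] (mod 2 ^ l) \<longleftrightarrow> l \<le> L + j"
      using iterated_square_cong_1 by blast
    have "unit_order 2 1 m = 1"
      using dvd_iff[of 1 1] assms by (simp add: cong_iff_dvd_diff)
    moreover have "unit_order 2 l m = 2 ^ Suc (l - L)" if "l > 1" for l
    proof (rule eq_prime_power_if_dvd_iff)
      fix j
      show "unit_order 2 l m dvd 2 ^ j \<longleftrightarrow> Suc (l - L) \<le> j"
      proof (cases j)
        case 0
        have "\<not> [m = 1] (mod 2 ^ l)"
        proof
          assume "[m = 1] (mod 2 ^ l)"
          moreover have "(2::int) ^ 2 dvd 2 ^ l"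
            using that by (intro le_imp_power_dvd) simp
          ultimately have "[m = 1] (mod 4)"
            using cong_dvd_modulus by fastforce
          with m(1) show False by (simp add: cong_def)
        qed
        then show ?thesis using dvd_iff[of l 1] that 0 by simp
      next
        case (Suc i)
        then show ?thesis
          using dvd_iff[of l "2 ^ j"] that L(2)[of i l] by (auto simp: power_mult)
      qed
    qed simp
    ultimately show "\<exists>L>0. \<forall>l\<ge>1. unit_order 2 l m =
        (if l = 1 then 1 else if l \<le> L then 2 else 2 ^ (l - (L - 1)))"
      using L(1) by (intro exI[of _ L]) (auto simp: Suc_diff_le)
  }
qed

end
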